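(* The QR factorization (computed with Householder reflections) of a banded-plus-semiseparable matrix yields a banded-plus-semiseparable factor matrix: if $A\in \mathrm{BPS}_{(r,p),(\ell,m)}^{n\times n}$, then the factor matrix $F_n$ of its Householder QR factorization satisfies $$F_n \in \mathrm{BPS}_{(r,\,r+p),(\ell,\,\ell+m)}^{n\times n}.$$
   Context: Notation: $M[a:b,c:d]$ is the submatrix of $M$ with rows $a,\dots,b$ and columns $c,\dots,d$. $\operatorname{tril}(M,-1)$ is the strictly lower triangular part of $M$ and $\operatorname{triu}(M,1)$ its strictly upper triangular part (other entries set to zero). Banded matrices: $\mathrm{BM}_{(\ell,m)}^{n\times n}$ is the set of $B=(b_{kj})\in\mathbb{R}^{n\times n}$ with $b_{kj}=0$ whenever $k-j>\ell$ or $j-k>m$. Banded-plus-semiseparable (BPS) matrices: $A\in \mathrm{BPS}_{(r,p),(\ell,m)}^{n\times n}$ if $A=B+\operatorname{tril}(UV^\top,-1)+\operatorname{triu}(WS^\top,1)$ for some $U,V\in\mathbb{R}^{n\times r}$, $W,S\in\mathbb{R}^{n\times p}$ and $B\in \mathrm{BM}_{(\ell,m)}^{n\times n}$. Householder QR: set $A^{(0)}=A$. For $k=1,\dots,n-1$ let $x=A^{(k-1)}[k:n,k]\in\mathbb{R}^{n-k+1}$ and $\alpha_k=\operatorname{sign}(x_1)\,\big|x_1+\operatorname{sign}(x_1)\|x\|_2\big|$. Let $\mathbf{y}_k\in\mathbb{R}^n$ have entries $0$ in positions $1,\dots,k-1$, entry $1$ in position $k$, and entry $x_{i-k+1}/\alpha_k$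 in positions $i=k+1,\dots,n$. Put $\tau_k=2\|\mathbf{y}_k\|_2^{-2}$ and $A^{(k)}=(I-\tau_k\mathbf{y}_k\mathbf{y}_k^\top)A^{(k-1)}$. Then $A=QR$ with $R=A^{(n-1)}$ upper triangular and $Q=(I-\tau_1\mathbf{y}_1\mathbf{y}_1^\top)\cdots(I-\tau_{n-1}\mathbf{y}_{n-1}\mathbf{y}_{n-1}^\top)$. Factor matrix: $F_n=F\in\mathbb{R}^{n\times n}$ is the matrix with $F[i,j]=R[i,j]$ for $i\le j$ and $F[i,j]=\mathbf{y}_j[i]$ for $i>j$; that is, its upper triangular part is $R$ and its strictly lower triangular part stores the Householder vectors. *)

theory Defs
  imports Complex_Main "Jordan_Normal_Form.Matrix"
begin

text \<open>
  Matrices are those of \<^theory>\<open>Jordan_Normal_Form.Matrix\<close>, so rows and columns are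
  numbered from 0.
\<close>

definition strict_tril :: "real mat \<Rightarrow> real mat" where
  "strict_tril M = mat (dim_row M) (dim_col M) (\<lambda>(i, j). if j < i then M $$ (i, j) else 0)"

definition strict_triu :: "real mat \<Rightarrow> real mat" where
  "strict_triu M = mat (dim_row M) (dim_col M) (\<lambda>(i, j). if i < j then M $$ (i, j) else 0)"

definition BM :: "nat \<Rightarrow> nat \<Rightarrow> nat \<Rightarrow> real mat set" where
  "BM n l m = {B \<in> carrier_mat n n.
     \<forall>k<n. \<forall>j<n. int k - int j > int l \<or> int j - int k > int m \<longrightarrow> B $$ (k, j) = 0}"

definition BPS :: "nat \<Rightarrow> nat \<times> nat \<Rightarrow> nat \<times> nat \<Rightarrow> real mat set" where
  "BPS n = (\<lambda>(r, p) (l, m).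
     {B + strict_tril (U * transpose_mat V) + strict_triu (W * transpose_mat S) | B U V W S.
        B \<in> BM n l m \<and> U \<in> carrier_mat n r \<and> V \<in> carrier_mat n r \<and>
        W \<in> carrier_mat n p \<and> S \<in> carrier_mat n p})"

definition norm2 :: "real vec \<Rightarrow> real" where
  "norm2 v = sqrt (v \<bullet> v)"

text \<open>
  Unlike \<^const>\<open>sgn\<close>, the sign used in Householder's method must be nonzero at 0: otherwise
  a column with vanishing pivot and nonzero subdiagonal part would not be reduced.
\<close>

definition hsign :: "real \<Rightarrow> real" where
  "hsign t = (if t < 0 then - 1 else 1)"

definition hh_alpha :: "real vec \<Rightarrow> real" where
  "hh_alpha x = hsign (x $ 0) * \<bar>x $ 0 + hsign (x $ 0) * norm2 x\<bar>"

definition hh_column :: "real mat \<Rightarrow> nat \<Rightarrow> real vec" where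
  "hh_column M k = vec (dim_row M - k) (\<lambda>i. M $$ (k + i, k))"

text \<open>
  If the column \<open>x\<close> is entirely zero, then \<open>hh_alpha x = 0\<close>, and division by zero yields 0, so
  the Householder vector is the \<open>k\<close>-th unit vector.
\<close>

definition hh_vec :: "real mat \<Rightarrow> nat \<Rightarrow> real vec" where
  "hh_vec M k = (let x = hh_column M k in
     vec (dim_row M) (\<lambda>i. if i < k then 0 else if i = k then 1 else x $ (i - k) / hh_alpha x))"

definition hh_tau :: "real vec \<Rightarrow> real" where
  "hh_tau y = 2 / (norm2 y)\<^sup>2"

definition hh_reflector :: "real vec \<Rightarrow> real mat" where
  "hh_reflector y =
     1\<^sub>m (dim_vec y) - hh_tau y \<cdot>\<^sub>m (transpose_mat (mat_of_row y) * mat_of_row y)"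

text \<open>
  \<open>hh_iter A k\<close> is the matrix after \<open>k\<close> steps; the step leading from \<open>k\<close> to \<open>Suc k\<close> treats
  the column with (zero-based) index \<open>k\<close>.
\<close>

primrec hh_iter :: "real mat \<Rightarrow> nat \<Rightarrow> real mat" where
  "hh_iter A 0 = A"
| "hh_iter A (Suc k) = hh_reflector (hh_vec (hh_iter A k) k) * hh_iter A k"

definition hh_R :: "real mat \<Rightarrow> real mat" where
  "hh_R A = hh_iter A (dim_row A - 1)"

definition factor_matrix :: "real mat \<Rightarrow> real mat" where
  "factor_matrix A = mat (dim_row A) (dim_row A)
     (\<lambda>(i, j). if i \<le> j then hh_R A $$ (i, j) else hh_vec (hh_iter A j) j $ i)"

end

theory Submission
  imports Defs
begin

text \<open>
  A matrix is banded-plus-semiseparable iff its columns, restricted to the rows below the band,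
  all lie in the span of \<open>r\<close> fixed vectors, and its rows, restricted to the columns right of the
  band, all lie in the span of \<open>p\<close> fixed vectors.

  Step \<open>s\<close> of Householder's method subtracts a rank-one matrix \<open>y\<^sub>s c\<^sub>s\<^sup>T\<close>, where
  \<open>c\<^sub>s\<close> is a multiple of \<open>y\<^sub>s\<^sup>T A\<^sup>(\<^sup>s\<^sup>)\<close>. By induction, \<open>y\<^sub>s\<close> lies below row \<open>s + l\<close> in the span of
  the columns of \<open>U\<close>. For \<open>j > s + l + m\<close>, split \<open>y\<^sub>s\<^sup>T A e\<^sub>j\<close> at row \<open>s + l\<close>: above, the entries of
  \<open>A e\<^sub>j\<close> come from \<open>W S\<^sup>T\<close> alone; below, \<open>y\<^sub>s\<close> is a combination of columns of \<open>U\<close>, and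
  the partial products with \<open>U\<close> differ from the entries of \<open>U\<^sup>T A e\<^sub>j\<close> only by rows that again
  come from \<open>W S\<^sup>T\<close>. So \<open>c\<^sub>s\<close>, and with it each row of \<open>R\<close>, lies beyond
  the band in the span of the \<open>p\<close> columns of \<open>S\<close> and the \<open>r\<close> columns of \<open>A\<^sup>T U\<close>.
\<close>

section \<open>Spans of finitely many functions on a restricted index set\<close>

definition in_span_on :: "'a set \<Rightarrow> nat \<Rightarrow> (nat \<Rightarrow> 'a \<Rightarrow> real) \<Rightarrow> ('a \<Rightarrow> real) \<Rightarrow> bool" where
  "in_span_on D N X f \<longleftrightarrow> (\<exists>c. \<forall>i\<in>D. f i = (\<Sum>q<N. c q * X q i))"

lemma in_span_on_cong:
  assumes "in_span_on D N X f" and "\<And>i. i \<in> D \<Longrightarrow> g i = f i"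
  shows "in_span_on D N X g"
  using assms unfolding in_span_on_def by auto

text \<open>The index sets beyond the band shrink as the step number grows, so this carries
  memberships from earlier steps over to later ones.\<close>

lemma in_span_on_mono: "in_span_on D N X f \<Longrightarrow> E \<subseteq> D \<Longrightarrow> in_span_on E N X f"
  unfolding in_span_on_def by blast

lemma in_span_on_zero: "in_span_on D N X (\<lambda>i. 0)"
  unfolding in_span_on_def by (rule exI[of _ "\<lambda>q. 0"]) simp

lemma in_span_on_add:
  assumes "in_span_on D N X f" and "in_span_on D N X g"
  shows "in_span_on D N X (\<lambda>i. f i + g i)"
proof -
  from assms obtain c d where "\<forall>i\<in>D. f i = (\<Sum>q<N. c q * X q i)"
    and "\<forall>i\<in>D. g i = (\<Sum>q<N. d q * X q i)"
    unfolding in_span_on_def by blast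
  then show ?thesis
    unfolding in_span_on_def
    by (intro exI[of _ "\<lambda>q. c q + d q"]) (simp add: distrib_right sum.distrib)
qed

lemma in_span_on_scale:
  assumes "in_span_on D N X f"
  shows "in_span_on D N X (\<lambda>i. a * f i)"
proof -
  from assms obtain c where "\<forall>i\<in>D. f i = (\<Sum>q<N. c q * X q i)"
    unfolding in_span_on_def by blast
  then show ?thesis
    unfolding in_span_on_def
    by (intro exI[of _ "\<lambda>q. a * c q"]) (simp add: sum_distrib_left mult.assoc)
qed

lemma in_span_on_diff:
  assumes "in_span_on D N X f" and "in_span_on D N X g"
  shows "in_span_on D N X (\<lambda>i. f i - g i)"
  using in_span_on_add[OF assms(1) in_span_on_scale[OF assms(2), of "-1"]] by simp

lemma in_span_on_sum:
  assumes "\<And>t. t \<in> T \<Longrightarrow> in_span_on D N X (f t)"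
  shows "in_span_on D N X (\<lambda>i. \<Sum>t\<in>T. f t i)"
  using assms
  by (induction T rule: infinite_finite_induct) (auto intro: in_span_on_zero in_span_on_add)

lemma in_span_on_base:
  assumes "q < N"
  shows "in_span_on D N X (X q)"
proof -
  have "X q i = (\<Sum>t<N. (if t = q then 1 else 0) * X t i)" for i
  proof -
    have "(\<Sum>t<N. (if t = q then 1 else 0) * X t i) = (\<Sum>t<N. if t = q then X t i else 0)"
      by (intro sum.cong) auto
    then show ?thesis using assms by simp
  qed
  then show ?thesis
    unfolding in_span_on_def by (intro exI[of _ "\<lambda>t. if t = q then 1 else 0"] ballI)
qed

lemma in_span_on_trans:
  assumes "in_span_on D N X f" and "\<And>q. q < N \<Longrightarrow> in_span_on D M Y (X q)"
  shows "in_span_on D M Y f"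
proof -
  from assms(1) obtain c where c: "\<forall>i\<in>D. f i = (\<Sum>q<N. c q * X q i)"
    unfolding in_span_on_def by blast
  have "in_span_on D M Y (\<lambda>i. \<Sum>q<N. c q * X q i)"
    using assms(2) by (intro in_span_on_sum in_span_on_scale) auto
  then show ?thesis
    by (rule in_span_on_cong) (simp add: c)
qed

section \<open>Banded-plus-semiseparable structure as span conditions\<close>

lemma mult_transpose_index:
  assumes "U \<in> carrier_mat n r" and "V \<in> carrier_mat n r" and "i < n" and "j < n"
  shows "(U * transpose_mat V) $$ (i, j) = (\<Sum>q<r. U $$ (i, q) * V $$ (j, q))"
  using assms by (auto simp: scalar_prod_def atLeast0LessThan intro!: sum.cong)

text \<open>The band part \<open>B\<close> absorbs any entry inside the band, so only entries
  strictly beyond it are constrained. The coefficients of column j form row j of \<open>V\<close>,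
  those of row i form row i of \<open>W\<close>; the spanning functions are the columns of
  \<open>U\<close> and \<open>S\<close>.\<close>

lemma BPS_iff_in_span_on:
  "A \<in> BPS n (r, p) (l, m) \<longleftrightarrow>
     A \<in> carrier_mat n n \<and>
     (\<exists>X. \<forall>j<n. in_span_on {i. j + l < i \<and> i < n} r X (\<lambda>i. A $$ (i, j))) \<and>
     (\<exists>Y. \<forall>i<n. in_span_on {j. i + m < j \<and> j < n} p Y (\<lambda>j. A $$ (i, j)))"
    (is "?L \<longleftrightarrow> ?C \<and> ?X \<and> ?Y")
proof
  assume ?L
  then obtain B U V W S where A: "A = B + strict_tril (U * transpose_mat V) + strict_triu (W * transpose_mat S)"
    and B: "B \<in> BM n l m" and U: "U \<in> carrier_mat n r" and V: "V \<in> carrier_mat n r"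
    and W: "W \<in> carrier_mat n p" and S: "S \<in> carrier_mat n p"
    unfolding BPS_def by auto
  have Bc: "B \<in> carrier_mat n n"
    and B0: "\<And>i j. i < n \<Longrightarrow> j < n \<Longrightarrow> j + l < i \<or> i + m < j \<Longrightarrow> B $$ (i, j) = 0"
    using B unfolding BM_def by auto
  have C: ?C
    unfolding A using Bc U V W S by (auto simp: strict_tril_def strict_triu_def)
  have entry: "A $$ (i, j) = B $$ (i, j) + (if j < i then (U * transpose_mat V) $$ (i, j) else 0)
      + (if i < j then (W * transpose_mat S) $$ (i, j) else 0)" if "i < n" "j < n" for i j
    unfolding A using that Bc U V W S by (simp add: strict_tril_def strict_triu_def)
  have ?X
    unfolding in_span_on_def
  proof (intro exI[of _ "\<lambda>q i. U $$ (i, q)"] allI impI)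
    fix j assume "j < n"
    then show "\<exists>c. \<forall>i\<in>{i. j + l < i \<and> i < n}. A $$ (i, j) = (\<Sum>q<r. c q * U $$ (i, q))"
      using U V
      by (intro exI[of _ "\<lambda>q. V $$ (j, q)"])
        (auto simp: entry B0 mult_transpose_index mult.commute simp del: index_mult_mat)
  qed
  moreover have ?Y
    unfolding in_span_on_def
  proof (intro exI[of _ "\<lambda>q j. S $$ (j, q)"] allI impI)
    fix i assume "i < n"
    then show "\<exists>c. \<forall>j\<in>{j. i + m < j \<and> j < n}. A $$ (i, j) = (\<Sum>q<p. c q * S $$ (j, q))"
      using W S
      by (intro exI[of _ "\<lambda>q. W $$ (i, q)"])
        (auto simp: entry B0 mult_transpose_index simp del: index_mult_mat)
  qed
  ultimately show "?C \<and> ?X \<and> ?Y" using C by blast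
next
  assume R: "?C \<and> ?X \<and> ?Y"
  then have C: ?C by blast
  from R obtain X where "\<forall>j<n. \<exists>c. \<forall>i\<in>{i. j + l < i \<and> i < n}. A $$ (i, j) = (\<Sum>q<r. c q * X q i)"
    unfolding in_span_on_def by blast
  then obtain v where v: "\<forall>j<n. \<forall>i\<in>{i. j + l < i \<and> i < n}. A $$ (i, j) = (\<Sum>q<r. v j q * X q i)"
    unfolding choice_iff' by (elim exE)
  from R obtain Y where "\<forall>i<n. \<exists>c. \<forall>j\<in>{j. i + m < j \<and> j < n}. A $$ (i, j) = (\<Sum>q<p. c q * Y q j)"
    unfolding in_span_on_def by blast
  then obtain w where w: "\<forall>i<n. \<forall>j\<in>{j. i + m < j \<and> j < n}. A $$ (i, j) = (\<Sum>q<p. w i q * Y q j)"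
    unfolding choice_iff' by (elim exE)
  define U V W S where "U = mat n r (\<lambda>(i, q). X q i)" and "V = mat n r (\<lambda>(j, q). v j q)"
    and "W = mat n p (\<lambda>(i, q). w i q)" and "S = mat n p (\<lambda>(j, q). Y q j)"
  note defs = U_def V_def W_def S_def
  have c: "U \<in> carrier_mat n r" "V \<in> carrier_mat n r" "W \<in> carrier_mat n p" "S \<in> carrier_mat n p"
    by (simp_all add: defs)
  define L where "L = strict_tril (U * transpose_mat V)"
  define T where "T = strict_triu (W * transpose_mat S)"
  have L: "L \<in> carrier_mat n n"
    and Lij: "\<And>i j. i < n \<Longrightarrow> j < n \<Longrightarrow> L $$ (i, j) = (if j < i then \<Sum>q<r. v j q * X q i else 0)"
    unfolding L_def strict_tril_def using c mult_transpose_index[OF c(1,2)]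
    by (auto simp: U_def V_def mult.commute simp del: index_mult_mat(1))
  have T: "T \<in> carrier_mat n n"
    and Tij: "\<And>i j. i < n \<Longrightarrow> j < n \<Longrightarrow> T $$ (i, j) = (if i < j then \<Sum>q<p. w i q * Y q j else 0)"
    unfolding T_def strict_triu_def using c mult_transpose_index[OF c(3,4)]
    by (auto simp: W_def S_def simp del: index_mult_mat(1))
  \<comment> \<open>Beyond the band exactly one of \<open>L\<close> and \<open>T\<close> is nonzero
    by definition's case split or sum, and it equals \<open>A\<close> there.\<close>
  have "A - L - T \<in> BM n l m"
    unfolding BM_def using C L T by (auto simp: Lij Tij v w minus_mat_def)
  moreover have "A = (A - L - T) + L + T"
    using C L T by (intro eq_matI) auto
  ultimately show ?L
    unfolding BPS_def using c L_def T_def by simp blast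
qed

section \<open>Entries of the Householder vectors and iterates\<close>

lemma dim_hh_vec [simp]: "dim_vec (hh_vec M k) = dim_row M"
  by (simp add: hh_vec_def Let_def)

lemma hh_vec_above: "i < k \<Longrightarrow> i < dim_row M \<Longrightarrow> hh_vec M k $ i = 0"
  by (simp add: hh_vec_def Let_def)

lemma hh_column_index: "k \<le> i \<Longrightarrow> i < dim_row M \<Longrightarrow> hh_column M k $ (i - k) = M $$ (i, k)"
  by (auto simp: hh_column_def le_iff_add)

lemma hh_vec_below:
  "k < i \<Longrightarrow> i < dim_row M \<Longrightarrow> hh_vec M k $ i = M $$ (i, k) / hh_alpha (hh_column M k)"
  by (simp add: hh_vec_def hh_column_index Let_def)

lemma hh_reflector_carrier: "hh_reflector y \<in> carrier_mat (dim_vec y) (dim_vec y)"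
  by (rule carrier_matI) (simp_all add: hh_reflector_def)

lemma hh_reflector_mult_index:
  assumes "M \<in> carrier_mat n n" and "dim_vec y = n" and "i < n" and "j < n"
  shows "(hh_reflector y * M) $$ (i, j) =
    M $$ (i, j) - y $ i * (hh_tau y * (\<Sum>t<n. y $ t * M $$ (t, j)))"
proof -
  have entry: "hh_reflector y $$ (i, t) = (if i = t then 1 else 0) - hh_tau y * (y $ i * y $ t)"
    if "t < n" for t
    using assms that by (simp add: hh_reflector_def scalar_prod_def mat_of_row_def)
  have "(hh_reflector y * M) $$ (i, j) = (\<Sum>t<n. hh_reflector y $$ (i, t) * M $$ (t, j))"
    using assms hh_reflector_carrier[of y]
    by (auto simp: scalar_prod_def atLeast0LessThan intro!: sum.cong)
  also have "\<dots> = (\<Sum>t<n. (if i = t then M $$ (t, j) else 0) - y $ i * (hh_tau y * (y $ t * M $$ (t, j))))"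
    by (intro sum.cong) (auto simp: entry algebra_simps)
  also have "\<dots> = M $$ (i, j) - y $ i * (hh_tau y * (\<Sum>t<n. y $ t * M $$ (t, j)))"
    using assms by (simp add: sum_subtractf sum_distrib_left)
  finally show ?thesis .
qed

lemma hh_iter_carrier: "A \<in> carrier_mat n n \<Longrightarrow> hh_iter A k \<in> carrier_mat n n"
  by (induction k) (auto simp: hh_reflector_def)

text \<open>This is entry \<open>j\<close> of the row c_s = tau_s y_s^T A^(s), so that step
  \<open>s\<close> subtracts y_s c_s^T.\<close>

definition hh_coeff :: "real mat \<Rightarrow> nat \<Rightarrow> nat \<Rightarrow> real" where
  "hh_coeff A s j = hh_tau (hh_vec (hh_iter A s) s) *
     (\<Sum>t<dim_row A. hh_vec (hh_iter A s) s $ t * hh_iter A s $$ (t, j))"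

text \<open>Unrolling the rank-one updates expresses every iterate through \<open>A\<close> itself,
  the only matrix whose structure is known in advance.\<close>

lemma hh_iter_index:
  assumes "A \<in> carrier_mat n n" and "i < n" and "j < n"
  shows "hh_iter A k $$ (i, j) =
    A $$ (i, j) - (\<Sum>s<k. hh_vec (hh_iter A s) s $ i * hh_coeff A s j)"
proof (induction k)
  case (Suc k)
  have "hh_iter A k \<in> carrier_mat n n" by (rule hh_iter_carrier[OF assms(1)])
  from hh_reflector_mult_index[OF this _ assms(2,3), of "hh_vec (hh_iter A k) k"] this
  show ?case using Suc assms(1) by (simp add: hh_coeff_def)
qed simp

section \<open>Householder vectors and rows of R in fixed spans\<close>

lemma hh_vec_in_span_on:
  assumes A: "A \<in> carrier_mat n n"
    and X: "\<forall>j<n. in_span_on {i. j + l < i \<and> i < n} r X (\<lambda>i. A $$ (i, j))"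
    and "s < n"
  shows "in_span_on {i. s + l < i \<and> i < n} r X (\<lambda>i. hh_vec (hh_iter A s) s $ i)"
  using \<open>s < n\<close>
proof (induction s rule: less_induct)
  case (less s)
  let ?D = "{i. s + l < i \<and> i < n}"
  let ?y = "\<lambda>t i. hh_vec (hh_iter A t) t $ i"
  have "in_span_on ?D r X (?y t)" if "t < s" for t
    by (rule in_span_on_mono[OF less.IH[OF that]]) (use that less.prems in auto)
  \<comment> \<open>Below its pivot, y_s is column \<open>s\<close> of the iterate divided by alpha,
    and that column is column \<open>s\<close> of \<open>A\<close> minus a combination of earlier
    y_t. If alpha is 0, its \<open>inverse\<close> is 0 and the scaling remains valid.\<close>
  then have "in_span_on ?D r X
      (\<lambda>i. inverse (hh_alpha (hh_column (hh_iter A s) s)) *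
        (A $$ (i, s) - (\<Sum>t<s. hh_coeff A t s * ?y t i)))"
    using X less.prems
    by (intro in_span_on_scale in_span_on_diff in_span_on_sum) auto
  then show ?case
    by (rule in_span_on_cong)
      (use hh_iter_carrier[OF A, of s] less.prems in
        \<open>simp add: hh_vec_below hh_iter_index[OF A] divide_inverse mult.commute\<close>)
qed

lemma hh_coeff_in_span_on:
  assumes A: "A \<in> carrier_mat n n"
    and X: "\<forall>j<n. in_span_on {i. j + l < i \<and> i < n} r X (\<lambda>i. A $$ (i, j))"
    and rows: "\<And>i. i < n \<Longrightarrow> in_span_on {j. i + m < j \<and> j < n} N Z (\<lambda>j. A $$ (i, j))"
    and XA: "\<And>q. q < r \<Longrightarrow> in_span_on {..<n} N Z (\<lambda>j. \<Sum>i<n. X q i * A $$ (i, j))"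
    and "s < n"
  shows "in_span_on {j. s + (l + m) < j \<and> j < n} N Z (hh_coeff A s)"
  using \<open>s < n\<close>
proof (induction s rule: less_induct)
  case (less s)
  let ?D = "{j. s + (l + m) < j \<and> j < n}"
  let ?y = "\<lambda>t i. hh_vec (hh_iter A t) t $ i"
  let ?hi = "{i. i < n \<and> i \<le> s + l}" and ?lo = "{i. s + l < i \<and> i < n}"
  have split: "sum f {..<n} = sum f ?hi + sum f ?lo" for f :: "nat \<Rightarrow> real"
    by (subst sum.union_disjoint[symmetric]) (auto intro!: arg_cong[where f = "sum f"])
  \<comment> \<open>A row i <= s + l has i + m <= s + (l + m), so all columns in \<open>?D\<close>
    lie beyond its band. This is where the upper bandwidth grows to l + m.\<close>
  have hi: "in_span_on ?D N Z (\<lambda>j. \<Sum>i\<in>?hi. g i * A $$ (i, j))" for g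
    by (intro in_span_on_sum in_span_on_scale, rule in_span_on_mono[OF rows]) auto
  obtain v where v: "\<And>i. i \<in> ?lo \<Longrightarrow> ?y s i = (\<Sum>q<r. v q * X q i)"
    using hh_vec_in_span_on[OF A X less.prems] unfolding in_span_on_def by blast
  have "in_span_on ?D N Z (\<lambda>j. \<Sum>i<n. X q i * A $$ (i, j))" if "q < r" for q
    by (rule in_span_on_mono[OF XA[OF that]]) auto
  \<comment> \<open>The partial product of \<open>X q\<close> with the low rows is the full product
    minus the high rows, which \<open>hi\<close> covers.\<close>
  then have "in_span_on ?D N Z
      (\<lambda>j. \<Sum>q<r. v q * ((\<Sum>i<n. X q i * A $$ (i, j)) - (\<Sum>i\<in>?hi. X q i * A $$ (i, j))))"
    by (intro in_span_on_sum[of "{..<r}"] in_span_on_scale in_span_on_diff hi) auto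
  then have lo: "in_span_on ?D N Z (\<lambda>j. \<Sum>i\<in>?lo. ?y s i * A $$ (i, j))"
  proof (rule in_span_on_cong)
    fix j
    have "(\<Sum>i\<in>?lo. ?y s i * A $$ (i, j)) = (\<Sum>i\<in>?lo. \<Sum>q<r. v q * (X q i * A $$ (i, j)))"
      by (intro sum.cong refl) (simp add: v sum_distrib_right mult.assoc)
    also have "\<dots> = (\<Sum>q<r. v q * (\<Sum>i\<in>?lo. X q i * A $$ (i, j)))"
      by (subst sum.swap) (simp add: sum_distrib_left)
    finally show "(\<Sum>i\<in>?lo. ?y s i * A $$ (i, j)) =
        (\<Sum>q<r. v q * ((\<Sum>i<n. X q i * A $$ (i, j)) - (\<Sum>i\<in>?hi. X q i * A $$ (i, j))))"
      by (simp add: split)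
  qed
  have IH: "in_span_on ?D N Z (hh_coeff A t)" if "t < s" for t
    by (rule in_span_on_mono[OF less.IH[OF that]]) (use that less.prems in auto)
  \<comment> \<open>By \<open>hh_iter_index\<close>, y_s^T A^(s) is y_s^T A minus the sum over t < s
    of (y_s^T y_t) c_t. The inner products do not depend on j, so the earlier c_t enter with
    constant coefficients.\<close>
  have "in_span_on ?D N Z
      (\<lambda>j. hh_tau (hh_vec (hh_iter A s) s) *
        ((\<Sum>i\<in>?hi. ?y s i * A $$ (i, j)) + (\<Sum>i\<in>?lo. ?y s i * A $$ (i, j))
          - (\<Sum>t<s. (\<Sum>i<n. ?y s i * ?y t i) * hh_coeff A t j)))"
    by (intro in_span_on_scale in_span_on_diff in_span_on_add in_span_on_sum[of "{..<s}"] hi lo IH) auto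
  then show ?case
  proof (rule in_span_on_cong)
    fix j assume "j \<in> ?D"
    then have j: "j < n" by simp
    have "(\<Sum>i<n. ?y s i * hh_iter A s $$ (i, j)) =
        (\<Sum>i<n. ?y s i * A $$ (i, j) - (\<Sum>t<s. ?y s i * ?y t i * hh_coeff A t j))"
      using j by (intro sum.cong refl)
        (simp add: hh_iter_index[OF A] right_diff_distrib sum_distrib_left mult.assoc)
    also have "\<dots> = (\<Sum>i<n. ?y s i * A $$ (i, j)) - (\<Sum>t<s. (\<Sum>i<n. ?y s i * ?y t i) * hh_coeff A t j)"
      by (simp add: sum_subtractf sum_distrib_right) (rule sum.swap)
    finally show "hh_coeff A s j = hh_tau (hh_vec (hh_iter A s) s) *
        ((\<Sum>i\<in>?hi. ?y s i * A $$ (i, j)) + (\<Sum>i\<in>?lo. ?y s i * A $$ (i, j))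
          - (\<Sum>t<s. (\<Sum>i<n. ?y s i * ?y t i) * hh_coeff A t j))"
      using A by (simp add: hh_coeff_def split)
  qed
qed

lemma hh_R_in_span_on:
  assumes A: "A \<in> carrier_mat n n"
    and X: "\<forall>j<n. in_span_on {i. j + l < i \<and> i < n} r X (\<lambda>i. A $$ (i, j))"
    and rows: "\<And>i. i < n \<Longrightarrow> in_span_on {j. i + m < j \<and> j < n} N Z (\<lambda>j. A $$ (i, j))"
    and XA: "\<And>q. q < r \<Longrightarrow> in_span_on {..<n} N Z (\<lambda>j. \<Sum>i<n. X q i * A $$ (i, j))"
    and i: "i < n"
  shows "in_span_on {j. i + (l + m) < j \<and> j < n} N Z (\<lambda>j. hh_R A $$ (i, j))"
proof -
  let ?D = "{j. i + (l + m) < j \<and> j < n}"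
  let ?y = "\<lambda>s. hh_vec (hh_iter A s) s $ i"
  \<comment> \<open>Since y_s vanishes above row s, only steps s <= i affect row i; for these,
    columns beyond i + l + m are also beyond s + l + m.\<close>
  have "in_span_on ?D N Z (\<lambda>j. ?y s * hh_coeff A s j)" if "s < n - 1" for s
  proof (cases "s \<le> i")
    case True
    then show ?thesis
      using that
      by (intro in_span_on_scale in_span_on_mono[OF hh_coeff_in_span_on[OF A X rows XA]]) auto
  next
    case False
    then have "?y s = 0" using i hh_iter_carrier[OF A, of s] by (simp add: hh_vec_above)
    then show ?thesis by (simp add: in_span_on_zero)
  qed
  then have "in_span_on ?D N Z (\<lambda>j. A $$ (i, j) - (\<Sum>s<n - 1. ?y s * hh_coeff A s j))"
    by (intro in_span_on_diff in_span_on_sum in_span_on_mono[OF rows[OF i]]) auto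
  then show ?thesis
    by (rule in_span_on_cong) (use A i in \<open>simp add: hh_R_def hh_iter_index[OF A]\<close>)
qed

theorem theorem1:
  fixes n r p l m :: nat and A :: "real mat"
  assumes "A \<in> BPS n (r, p) (l, m)"
  shows "factor_matrix A \<in> BPS n (r, r + p) (l, l + m)"
proof -
  from assms obtain X Y where A: "A \<in> carrier_mat n n"
    and X: "\<forall>j<n. in_span_on {i. j + l < i \<and> i < n} r X (\<lambda>i. A $$ (i, j))"
    and Y: "\<forall>i<n. in_span_on {j. i + m < j \<and> j < n} p Y (\<lambda>j. A $$ (i, j))"
    unfolding BPS_iff_in_span_on by blast
  \<comment> \<open>The first r functions are the rows of X^T A, the remaining p are the original
    \<open>Y\<close>; hence the rank r + p.\<close>
  define Z where "Z q j = (if q < r then \<Sum>i<n. X q i * A $$ (i, j) else Y (q - r) j)" for q j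
  have ZX: "in_span_on D (r + p) Z (\<lambda>j. \<Sum>i<n. X q i * A $$ (i, j))" if "q < r" for q D
    using in_span_on_base[of q "r + p" D Z] that by (simp add: Z_def[abs_def])
  have ZY: "in_span_on D (r + p) Z (Y q)" if "q < p" for q D
    using in_span_on_base[of "r + q" "r + p" D Z] that by (simp add: Z_def[abs_def])
  have rows: "in_span_on {j. i + m < j \<and> j < n} (r + p) Z (\<lambda>j. A $$ (i, j))" if "i < n" for i
    using Y that by (auto intro: in_span_on_trans ZY)
  have "in_span_on {i. j + l < i \<and> i < n} r X (\<lambda>i. factor_matrix A $$ (i, j))" if "j < n" for j
    by (rule in_span_on_cong[OF hh_vec_in_span_on[OF A X that]])
      (use A that in \<open>auto simp: factor_matrix_def\<close>)
  moreover have "in_span_on {j. i + (l + m) < j \<and> j < n} (r + p) Z (\<lambda>j. factor_matrix A $$ (i, j))"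
    if "i < n" for i
    by (rule in_span_on_cong[OF hh_R_in_span_on[OF A X rows ZX that]])
      (use A that in \<open>auto simp: factor_matrix_def\<close>)
  moreover have "factor_matrix A \<in> carrier_mat n n"
    using A by (simp add: factor_matrix_def)
  ultimately show ?thesis
    unfolding BPS_iff_in_span_on by blast
qed

end
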